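(* Let $\mu\in\mathbb{R}$ with $\mu\neq 0$ and let $b>a>0$. For $\nu\neq 0$, let $\Psi_{[a,b]}(\nu)$ denote the probability that a Brownian motion with drift $\nu$, started at the origin at time zero, crosses zero in the time interval $[a,b]$. Then $$\lim_{r\to\infty}\frac{1}{r}\log\Psi_{[a,b]}(\mu\sqrt{r})=-\frac{\mu^2}{2}a\quad\text{and}\quad\lim_{r\to\infty}e^{\frac{\mu^2ra}{2}}\sqrt{r}\,\Psi_{[a,b]}(\mu\sqrt{r})=\sqrt{\frac{2}{\pi\mu^2a}}.$$
   Context: For $\nu\neq 0$, the Brownian motion with drift $\nu$ is $B^{\nu}(s)=B(s)+\nu s$, $s\geq 0$, with $B$ a standard Brownian motion and $B(0)=0$; $\Psi_{[a,b]}(\nu)=P(\exists\, s\in[a,b]: B^{\nu}(s)=0)$. It is known (a recalled fact from earlier literature) that for $b>a>0$ $$\Psi_{[a,b]}(\nu)=\frac{1}{\pi}\int_0^{b-a}\frac{e^{-\frac{\nu^2}{2}(a+s)}}{a+s}\sqrt{\frac{a}{s}}\,ds,$$ and this formula may be taken as the definition of $\Psi_{[a,b]}(\nu)$. *)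

theory Defs
  imports "HOL-Analysis.Analysis"
begin

text \<open>
  The probability that a Brownian motion with drift \<open>\<nu>\<close>, \<open>\<nu> \<noteq> 0\<close>, started at the origin at
  time zero, hits zero during the time interval \<open>[a,b]\<close>, \<open>0 < a < b\<close>, given by its known
  integral representation, which is taken as the definition. The process itself is not
  constructed. The integral is a Lebesgue integral with an integrable singularity at \<open>s = 0\<close>.
\<close>

definition zero_crossing_prob :: "real \<Rightarrow> real \<Rightarrow> real \<Rightarrow> real" where
  "zero_crossing_prob a b \<nu> =
     1 / pi * (LBINT s:{0<..b - a}. exp (- (\<nu>\<^sup>2 / 2) * (a + s)) / (a + s) * sqrt (a / s))"

end

theory Submission
  imports Defs "HOL-Real_Asymp.Real_Asymp"
begin

text \<open>
  Put \<open>l = \<mu>\<^sup>2 r / 2\<close>, which tends to infinity with \<open>r\<close>. The factor \<open>exp (- l * a)\<close> comes out of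
  the integral that represents the crossing probability, and up to the constant \<open>sqrt a / pi\<close>
  what remains is the Laplace transform at \<open>l\<close> of \<open>s powr (- 1 / 2) / (a + s)\<close>, truncated at
  \<open>b - a\<close>. For large \<open>l\<close> this transform only feels the behaviour of its argument at \<open>0\<close>, where
  \<open>1 / (a + s)\<close> can be replaced by \<open>1 / a\<close>: it is asymptotic to \<open>Gamma (1 / 2) / (a * sqrt l)\<close>
  (lemma \<open>laplace_transform_asymptotics\<close>, the leading term of Watson's lemma). Since
  \<open>Gamma (1 / 2) = sqrt pi\<close>, the second limit follows.

  The first limit is a weakening of the second: if \<open>exp (k * r) * sqrt r * f r\<close> has a positive
  limit, then its logarithm is bounded for large \<open>r\<close>, so \<open>ln (f r) = - k * r - ln r / 2 + O(1)\<close>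
  (lemma \<open>exponential_rate_of_asymptotics\<close>).
\<close>

lemma has_bochner_integral_Gamma:
  fixes \<alpha> :: real
  assumes "\<alpha> > 0"
  shows "has_bochner_integral lborel
           (\<lambda>t. indicator {0<..} t * (exp (- t) * t powr (\<alpha> - 1))) (Gamma \<alpha>)"
proof -
  have "(\<integral>\<^sup>+t. ennreal (indicator {0<..} t * (exp (- t) * t powr (\<alpha> - 1))) \<partial>lborel)
      = (\<integral>\<^sup>+t. ennreal (indicator {0..} t * t powr (\<alpha> - 1) / exp t) \<partial>lborel)"
    by (intro nn_integral_cong) (auto simp: indicator_def exp_minus field_simps)
  also have "\<dots> = ennreal (Gamma \<alpha>)"
    by (rule Gamma_conv_nn_integral_real[OF assms, symmetric])
  finally show ?thesis
    using assms by (intro has_bochner_integral_nn_integral) (auto simp: Gamma_real_pos less_imp_le)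
qed

text \<open>
  The substitution \<open>t = l * s\<close> turns the scaled transform into the integral of
  \<open>exp (- t) * t powr (\<alpha> - 1) * g (t / l)\<close>. As \<open>l\<close> grows, \<open>t / l\<close> tends to \<open>0\<close> from the right, so
  the integrand converges pointwise to \<open>g0\<close> times that of the Gamma function, which, times the
  bound on \<open>g\<close>, also dominates it.
\<close>

lemma laplace_transform_asymptotics:
  fixes g :: "real \<Rightarrow> real" and \<alpha> g0 C :: real
  assumes \<alpha>: "\<alpha> > 0"
    and [measurable]: "g \<in> borel_measurable borel"
    and bound: "\<And>s. s > 0 \<Longrightarrow> \<bar>g s\<bar> \<le> C"
    and lim: "(g \<longlongrightarrow> g0) (at_right 0)"
  shows "((\<lambda>l. l powr \<alpha> * (LBINT s:{0<..}. exp (- l * s) * s powr (\<alpha> - 1) * g s))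
            \<longlongrightarrow> Gamma \<alpha> * g0) at_top"
proof -
  define k :: "real \<Rightarrow> real" where "k t = indicator {0<..} t * (exp (- t) * t powr (\<alpha> - 1))" for t
  have k: "has_bochner_integral lborel k (Gamma \<alpha>)"
    unfolding k_def by (rule has_bochner_integral_Gamma[OF \<alpha>])
  have k_nonneg: "k t \<ge> 0" for t
    by (simp add: k_def)
  have [measurable]: "k \<in> borel_measurable borel"
    unfolding k_def by measurable
  have scaled: "(\<integral>t. k t * g (t / l) \<partial>lborel)
      = l powr \<alpha> * (LBINT s:{0<..}. exp (- l * s) * s powr (\<alpha> - 1) * g s)" if "l > 0" for l
  proof -
    have "(\<integral>t. k t * g (t / l) \<partial>lborel) = l * (\<integral>s. k (l * s) * g s \<partial>lborel)"
      using lborel_integral_real_affine[of l "\<lambda>t. k t * g (t / l)" 0] \<open>l > 0\<close> by simp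
    also have "(\<lambda>s. k (l * s) * g s) = (\<lambda>s. l powr (\<alpha> - 1) *
        (indicator {0<..} s *\<^sub>R (exp (- l * s) * s powr (\<alpha> - 1) * g s)))"
      using \<open>l > 0\<close>
      by (auto simp: fun_eq_iff k_def indicator_def powr_mult zero_less_mult_iff)
    also have "l * (\<integral>s. l powr (\<alpha> - 1) *
        (indicator {0<..} s *\<^sub>R (exp (- l * s) * s powr (\<alpha> - 1) * g s)) \<partial>lborel)
      = l powr \<alpha> * (LBINT s:{0<..}. exp (- l * s) * s powr (\<alpha> - 1) * g s)"
    proof -
      have "l * l powr (\<alpha> - 1) = l powr \<alpha>"
        using \<open>l > 0\<close> by (simp add: powr_mult_base)
      then show ?thesis
        unfolding set_lebesgue_integral_def integral_mult_right_zero by (simp only: flip: mult.assoc)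
    qed
    finally show ?thesis .
  qed
  have "((\<lambda>l. \<integral>t. k t * g (t / l) \<partial>lborel) \<longlongrightarrow> (\<integral>t. k t * g0 \<partial>lborel)) at_top"
  proof (rule integral_dominated_convergence_at_top)
    show "integrable lborel (\<lambda>t. k t * C)"
      using k by (auto simp: has_bochner_integral_iff)
    show "AE t in lborel. ((\<lambda>l. k t * g (t / l)) \<longlongrightarrow> k t * g0) at_top"
    proof (rule AE_I2)
      fix t :: real
      show "((\<lambda>l. k t * g (t / l)) \<longlongrightarrow> k t * g0) at_top"
      proof (cases "t > 0")
        case True
        then have "filterlim (\<lambda>l. t / l) (at_right 0) at_top"
          by real_asymp
        then show ?thesis
          by (intro tendsto_mult tendsto_const filterlim_compose[OF lim])
      qed (simp add: k_def)
    qed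
    show "\<forall>\<^sub>F l in at_top. AE t in lborel. norm (k t * g (t / l)) \<le> k t * C"
      using eventually_gt_at_top[of 0]
    proof eventually_elim
      case (elim l)
      show ?case
      proof (rule AE_I2)
        fix t :: real
        show "norm (k t * g (t / l)) \<le> k t * C"
        proof (cases "t > 0")
          case True
          then show ?thesis
            using elim k_nonneg[of t] by (simp add: abs_mult mult_left_mono bound)
        qed (simp add: k_def)
      qed
    qed
  qed measurable
  also have "(\<integral>t. k t * g0 \<partial>lborel) = Gamma \<alpha> * g0"
    using k by (simp add: has_bochner_integral_iff)
  finally show ?thesis
    by (rule Lim_transform_eventually)
       (use scaled in \<open>auto intro: eventually_mono[OF eventually_gt_at_top[of 0]]\<close>)
qed

lemma exponential_rate_of_asymptotics:
  fixes f :: "real \<Rightarrow> real" and k c :: real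
  assumes lim: "((\<lambda>r. exp (k * r) * sqrt r * f r) \<longlongrightarrow> c) at_top" and "c > 0"
  shows "((\<lambda>r. 1 / r * ln (f r)) \<longlongrightarrow> - k) at_top"
proof -
  define F where "F r = exp (k * r) * sqrt r * f r" for r
  have F: "(F \<longlongrightarrow> c) at_top"
    using lim by (simp add: F_def[abs_def])
  have "((\<lambda>r. ln (F r) * (1 / r) - k - ln r / (2 * r)) \<longlongrightarrow> ln c * 0 - k - 0) at_top"
  proof (intro tendsto_intros F)
    show "((\<lambda>r::real. 1 / r) \<longlongrightarrow> 0) at_top" "((\<lambda>r::real. ln r / (2 * r)) \<longlongrightarrow> 0) at_top"
      by real_asymp+
  qed (use \<open>c > 0\<close> in auto)
  moreover have "\<forall>\<^sub>F r in at_top. ln (F r) * (1 / r) - k - ln r / (2 * r) = 1 / r * ln (f r)"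
    using eventually_gt_at_top[of 0] order_tendstoD(1)[OF F \<open>c > 0\<close>]
  proof eventually_elim
    case (elim r)
    then have "f r > 0"
      using zero_less_mult_pos[of "exp (k * r) * sqrt r" "f r"] by (simp add: F_def)
    then have "ln (F r) = k * r + ln r / 2 + ln (f r)"
      using elim by (simp add: F_def ln_mult ln_sqrt)
    then show ?case
      using elim by (simp add: field_simps)
  qed
  ultimately show ?thesis
    by (simp add: Lim_transform_eventually)
qed

text \<open>
  The cut-off at \<open>b - a\<close> is moved into the function whose Laplace transform is taken, where it
  does not affect the limit at \<open>0\<close>.
\<close>

lemma zero_crossing_prob_eq_laplace_transform:
  fixes a b \<nu> :: real
  assumes "0 < a"
  shows "zero_crossing_prob a b \<nu> = sqrt a / pi * exp (- (\<nu>\<^sup>2 / 2) * a) *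
    (LBINT s:{0<..}. exp (- (\<nu>\<^sup>2 / 2) * s) * s powr (1 / 2 - 1) *
       (indicator {0<..b - a} s / (a + s)))"
proof -
  have "indicator {0<..b - a} s *\<^sub>R (exp (- (\<nu>\<^sup>2 / 2) * (a + s)) / (a + s) * sqrt (a / s))
      = sqrt a * exp (- (\<nu>\<^sup>2 / 2) * a) * (indicator {0<..} s *\<^sub>R (exp (- (\<nu>\<^sup>2 / 2) * s) *
          s powr (1 / 2 - 1) * (indicator {0<..b - a} s / (a + s))))" for s :: real
    by (auto simp: indicator_def real_sqrt_divide powr_minus powr_half_sqrt field_simps
          simp flip: exp_add)
  then show ?thesis
    unfolding zero_crossing_prob_def set_lebesgue_integral_def
    by (simp only: integral_mult_right_zero) simp
qed

lemma zero_crossing_prob_asymptotics: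
  fixes \<mu> a b :: real
  assumes "\<mu> \<noteq> 0" and "0 < a" and "a < b"
  shows "((\<lambda>r. exp (\<mu>\<^sup>2 * r * a / 2) * sqrt r * zero_crossing_prob a b (\<mu> * sqrt r))
            \<longlongrightarrow> sqrt (2 / (pi * \<mu>\<^sup>2 * a))) at_top"
proof -
  define g :: "real \<Rightarrow> real" where "g s = indicator {0<..b - a} s / (a + s)" for s
  define T where
    "T l = l powr (1 / 2) * (LBINT s:{0<..}. exp (- l * s) * s powr (1 / 2 - 1) * g s)" for l
  have "(T \<longlongrightarrow> Gamma (1 / 2) * (1 / a)) at_top"
    unfolding T_def
  proof (rule laplace_transform_asymptotics)
    show "g \<in> borel_measurable borel"
      unfolding g_def by measurable
    show "\<bar>g s\<bar> \<le> 1 / a" if "s > 0" for s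
      using that \<open>0 < a\<close> by (auto simp: g_def indicator_def field_simps)
    have "((\<lambda>s. 1 / (a + s)) \<longlongrightarrow> 1 / (a + 0)) (at_right 0)"
      using \<open>0 < a\<close> by (intro tendsto_intros) auto
    moreover have "\<forall>\<^sub>F s in at_right 0. 1 / (a + s) = g s"
      using eventually_at_right_real[of 0 "b - a"] \<open>a < b\<close>
      by (auto simp: g_def elim!: eventually_mono)
    ultimately show "(g \<longlongrightarrow> 1 / a) (at_right 0)"
      by (simp add: Lim_transform_eventually)
  qed simp
  moreover have "filterlim (\<lambda>r. \<mu>\<^sup>2 / 2 * r) at_top at_top"
    using \<open>\<mu> \<noteq> 0\<close> by (intro filterlim_tendsto_pos_mult_at_top[OF tendsto_const] filterlim_ident) auto
  ultimately have "((\<lambda>r. T (\<mu>\<^sup>2 / 2 * r)) \<longlongrightarrow> Gamma (1 / 2) * (1 / a)) at_top"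
    by (rule filterlim_compose)
  \<comment> \<open>With \<open>l = \<mu>\<^sup>2 / 2 * r\<close>, the factor \<open>sqrt r\<close> of the claim is \<open>sqrt (2 / \<mu>\<^sup>2)\<close> times the
    scaling \<open>sqrt l\<close> in \<open>T\<close>.\<close>
  then have "((\<lambda>r. sqrt a / pi * sqrt (2 / \<mu>\<^sup>2) * T (\<mu>\<^sup>2 / 2 * r))
      \<longlongrightarrow> sqrt a / pi * sqrt (2 / \<mu>\<^sup>2) * (Gamma (1 / 2) * (1 / a))) at_top"
    by (intro tendsto_intros)
  also have "sqrt a / pi * sqrt (2 / \<mu>\<^sup>2) * (Gamma (1 / 2) * (1 / a)) = sqrt (2 / (pi * \<mu>\<^sup>2 * a))"
    using assms real_div_sqrt[of pi] real_div_sqrt[of a]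
    by (simp add: Gamma_one_half_real real_sqrt_divide real_sqrt_mult field_simps)
  finally show ?thesis
  proof (rule Lim_transform_eventually)
    show "\<forall>\<^sub>F r in at_top. sqrt a / pi * sqrt (2 / \<mu>\<^sup>2) * T (\<mu>\<^sup>2 / 2 * r)
        = exp (\<mu>\<^sup>2 * r * a / 2) * sqrt r * zero_crossing_prob a b (\<mu> * sqrt r)"
      using eventually_gt_at_top[of 0]
    proof eventually_elim
      case (elim r)
      define l where "l = \<mu>\<^sup>2 / 2 * r"
      define J where "J = (LBINT s:{0<..}. exp (- l * s) * s powr (1 / 2 - 1) * g s)"
      have l: "l > 0" "(\<mu> * sqrt r)\<^sup>2 / 2 = l" "\<mu>\<^sup>2 * r * a / 2 = l * a"
        using elim \<open>\<mu> \<noteq> 0\<close> by (simp_all add: l_def power_mult_distrib)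
      have "sqrt a / pi * sqrt (2 / \<mu>\<^sup>2) * T l
          = sqrt a / pi * (sqrt (2 / \<mu>\<^sup>2) * sqrt l) * J"
        using l(1) by (simp add: T_def J_def powr_half_sqrt)
      also have "sqrt (2 / \<mu>\<^sup>2) * sqrt l = sqrt r"
        using elim \<open>\<mu> \<noteq> 0\<close> by (simp add: l_def flip: real_sqrt_mult)
      also have "sqrt a / pi * sqrt r * J
          = exp (l * a) * sqrt r * (sqrt a / pi * exp (- l * a) * J)"
        by (simp add: exp_minus)
      also have "sqrt a / pi * exp (- l * a) * J = zero_crossing_prob a b (\<mu> * sqrt r)"
        unfolding zero_crossing_prob_eq_laplace_transform[OF \<open>0 < a\<close>] l J_def g_def ..
      finally show ?case
        unfolding l(3) l_def[symmetric] .
    qed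
  qed
qed

theorem proposition2p3:
  fixes \<mu> a b :: real
  assumes "\<mu> \<noteq> 0" and "0 < a" and "a < b"
  shows "((\<lambda>r::real. 1 / r * ln (zero_crossing_prob a b (\<mu> * sqrt r)))
            \<longlongrightarrow> - (\<mu>\<^sup>2 / 2) * a) at_top
       \<and> ((\<lambda>r::real. exp (\<mu>\<^sup>2 * r * a / 2) * sqrt r * zero_crossing_prob a b (\<mu> * sqrt r))
            \<longlongrightarrow> sqrt (2 / (pi * \<mu>\<^sup>2 * a))) at_top"
proof -
  note asymp = zero_crossing_prob_asymptotics[OF assms]
  have "((\<lambda>r. exp (\<mu>\<^sup>2 / 2 * a * r) * sqrt r * zero_crossing_prob a b (\<mu> * sqrt r))
            \<longlongrightarrow> sqrt (2 / (pi * \<mu>\<^sup>2 * a))) at_top"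
    using asymp by (simp add: mult_ac)
  from exponential_rate_of_asymptotics[OF this] show ?thesis
    using asymp assms by simp
qed

end
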